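(* For every positive integer $k$, $$c_{k,3} \leq 1 - \frac{1}{(1+2^{1/k})^k}$$ and $$\tilde{c}_{k,3} \leq 1 - \frac{1}{(1+2^{1/k})^k}.$$
   Context: A subset $A$ of an additive group is called $3$-fold-sumfree if $x_1+x_2+x_3 \neq z$ for all $x_1,x_2,x_3,z\in A$ (not necessarily distinct). Subsets of $\{1,\ldots,n\}^k$ are regarded as subsets of the additive group $\mathbb{Z}^k$, subsets of $[0,1]^k$ as subsets of the additive group $\mathbb{R}^k$, and $\mathrm{Vol}$ denotes Lebesgue measure on $\mathbb{R}^k$. Define $$c_{k,3} := \limsup_{n \to \infty} \frac{1}{n^k} \max \{\#S : S \subset \{1,\ldots,n\}^k \text{ is } 3\text{-fold-sumfree}\},$$ $$\tilde{c}_{k,3} := \sup \{\mathrm{Vol}(S) : S \subset [0,1]^k \text{ is Lebesgue measurable and } 3\text{-fold-sumfree}\}.$$ *)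

theory Defs
  imports "HOL-Analysis.Analysis"
begin

definition three_fold_sumfree :: "'a::ab_group_add set \<Rightarrow> bool" where
  "three_fold_sumfree A \<longleftrightarrow>
     (\<forall>x1\<in>A. \<forall>x2\<in>A. \<forall>x3\<in>A. \<forall>z\<in>A. x1 + x2 + x3 \<noteq> z)"

text \<open>The dimension \<open>k\<close> is the cardinality of the finite index type \<open>'k\<close>, so the positivity
  of \<open>k\<close> is automatic.\<close>

definition grid :: "nat \<Rightarrow> (int ^ 'k::finite) set" where
  "grid n = {x. \<forall>i. x $ i \<in> {1..int n}}"

definition unit_box :: "(real ^ 'k::finite) set" where
  "unit_box = {x. \<forall>i. x $ i \<in> {0..1}}"

definition max_sumfree_card :: "'k::finite itself \<Rightarrow> nat \<Rightarrow> nat" where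
  "max_sumfree_card _ n = Max {card S |S :: (int ^ 'k) set. S \<subseteq> grid n \<and> three_fold_sumfree S}"

text \<open>The library's \<open>limsup\<close> lives on complete lattices, hence the value in \<open>ereal\<close>.\<close>

definition c3 :: "'k::finite itself \<Rightarrow> ereal" where
  "c3 k = limsup (\<lambda>n. ereal (real (max_sumfree_card k n) / real n ^ CARD('k)))"

definition c3_tilde :: "'k::finite itself \<Rightarrow> real" where
  "c3_tilde _ = Sup {measure lebesgue S |S :: (real ^ 'k) set.
     S \<subseteq> unit_box \<and> S \<in> sets lebesgue \<and> three_fold_sumfree S}"

text \<open>The maximum and the real supremum above are taken over nonempty sets that are finite,
  respectively bounded above, so neither of them is a junk value.\<close>

lemma max_sumfree_card_wf:
  fixes n :: nat
  defines "X \<equiv> {card S |S :: (int ^ 'k::finite) set. S \<subseteq> grid n \<and> three_fold_sumfree S}"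
  shows "finite X" and "X \<noteq> {}"
proof -
  have "(grid n :: (int ^ 'k) set) \<subseteq> vec_lambda ` (UNIV \<rightarrow>\<^sub>E {1..int n})"
  proof
    fix x :: "int ^ 'k" assume "x \<in> grid n"
    then have "vec_nth x \<in> UNIV \<rightarrow>\<^sub>E {1..int n}"
      by (simp add: grid_def PiE_def Pi_def)
    then show "x \<in> vec_lambda ` (UNIV \<rightarrow>\<^sub>E {1..int n})"
      by (intro image_eqI[where x = "vec_nth x"]) simp_all
  qed
  moreover have "finite (vec_lambda ` ((UNIV :: 'k set) \<rightarrow>\<^sub>E {1..int n}))"
    by (intro finite_imageI finite_PiE) simp_all
  ultimately have "finite (grid n :: (int ^ 'k) set)"
    by (rule finite_subset)
  then have "finite (card ` Pow (grid n :: (int ^ 'k) set))"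
    by simp
  then show "finite X"
    by (rule rev_finite_subset) (auto simp: X_def)
  have "card ({} :: (int ^ 'k) set) \<in> X"
    unfolding X_def by (intro CollectI exI[where x = "{}"]) (simp add: three_fold_sumfree_def)
  then show "X \<noteq> {}" by blast
qed

lemma c3_tilde_wf:
  defines "X \<equiv> {measure lebesgue S |S :: (real ^ 'k::finite) set.
     S \<subseteq> unit_box \<and> S \<in> sets lebesgue \<and> three_fold_sumfree S}"
  shows "bdd_above X" and "X \<noteq> {}"
proof -
  have box: "(unit_box :: (real ^ 'k) set) = cbox (\<chi> i. 0) (\<chi> i. 1)"
    by (auto simp: unit_box_def mem_box_cart)
  show "bdd_above X"
  proof (rule bdd_aboveI)
    fix v assume "v \<in> X"
    then obtain S :: "(real ^ 'k) set"
      where "v = measure lebesgue S" "S \<subseteq> unit_box" "S \<in> sets lebesgue"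
      unfolding X_def by blast
    then show "v \<le> measure lebesgue (unit_box :: (real ^ 'k) set)"
      unfolding box by (metis measure_mono_fmeasurable lmeasurable_cbox)
  qed
  have "measure lebesgue ({} :: (real ^ 'k) set) \<in> X"
    unfolding X_def by (intro CollectI exI[where x = "{}"]) (simp add: three_fold_sumfree_def)
  then show "X \<noteq> {}" by blast
qed

end

theory Submission imports Defs begin

text \<open>Let \<open>a = 1 / (1 + 2 powr (1 / k))\<close>, so that \<open>a < 1/2\<close> and \<open>(1 - a) ^ k = 2 * a ^ k\<close>, and let
  \<open>d = (1 - a, \<dots>, 1 - a)\<close>. If \<open>S\<close> contains both a pair \<open>x\<close>, \<open>x + d\<close> and a pair \<open>y\<close>, \<open>d - y\<close>,
  then \<open>x + y + (d - y) = x + d\<close>, so \<open>S\<close> is not 3-fold-sumfree. If the first kind of pair is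
  missing, then for each \<open>x\<close> in the corner box of side \<open>a\<close> at the origin the complement
  of \<open>S\<close> contains \<open>x\<close> or \<open>x + d\<close>, and the latter point lies in the disjoint opposite corner box; so
  the complement has volume at least \<open>a ^ k\<close>. If the second kind is missing, the complement and its
  reflection cover the box of side \<open>1 - a\<close>, so its volume is at least \<open>(1 - a) ^ k / 2 = a ^ k\<close>.
  The discrete case is the same with \<open>d \<approx> ((1 - a) n, \<dots>, (1 - a) n)\<close>.\<close>

section \<open>The dichotomy for sumfree sets and the choice of \<open>a\<close>\<close>

lemma three_fold_sumfree_cases:
  assumes "three_fold_sumfree S"
  obtains "\<And>x. x \<in> S \<Longrightarrow> x + d \<notin> S" | "\<And>y. y \<in> S \<Longrightarrow> d - y \<notin> S"
proof (cases "\<exists>x\<in>S. x + d \<in> S")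
  case True
  then obtain x where x: "x \<in> S" "x + d \<in> S" by blast
  have "d - y \<notin> S" if "y \<in> S" for y
  proof
    assume "d - y \<in> S"
    then have "x + y + (d - y) \<noteq> x + d"
      using assms x that unfolding three_fold_sumfree_def by blast
    then show False by simp
  qed
  then show ?thesis using that(2) by blast
next
  case False
  then show ?thesis using that(1) by blast
qed

text \<open>The two cases leave complements of size at least \<open>a ^ k\<close> and
  \<open>(1 - a) ^ k / 2\<close>. The first grows with \<open>a\<close> and the second shrinks, so
  the best guarantee is where they agree, that is where \<open>1 - a\<close> is
  \<open>2 powr (1 / k)\<close> times \<open>a\<close>.\<close>

lemma balanced_ratio:
  fixes k :: nat and a :: real
  assumes "k > 0"
  defines "a \<equiv> 1 / (1 + 2 powr (1 / real k))"
  shows "0 < a" and "a < 1 / 2" and "(1 - a) ^ k = 2 * a ^ k"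
proof -
  define b :: real where "b = 2 powr (1 / real k)"
  have b: "b > 1" unfolding b_def using assms(1) by simp
  have bk: "b ^ k = 2"
    unfolding b_def using assms(1) by (simp add: powr_realpow[symmetric] powr_powr)
  have a: "a = 1 / (1 + b)" by (simp add: a_def b_def)
  show "0 < a" "a < 1 / 2" using b by (simp_all add: a field_simps)
  have "1 - a = b * a" using b by (simp add: a field_simps)
  then show "(1 - a) ^ k = 2 * a ^ k" by (simp add: power_mult_distrib bk)
qed

section \<open>Sumfree subsets of the integer grid\<close>

lemma card_grid:
  "finite (grid n :: (int ^ 'k::finite) set)" "card (grid n :: (int ^ 'k) set) = n ^ CARD('k)"
proof -
  have eq: "(grid n :: (int ^ 'k) set) = vec_lambda ` (UNIV \<rightarrow>\<^sub>E {1..int n})"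
  proof (intro set_eqI iffI)
    fix x :: "int ^ 'k" assume "x \<in> grid n"
    then show "x \<in> vec_lambda ` (UNIV \<rightarrow>\<^sub>E {1..int n})"
      by (intro image_eqI[where x = "vec_nth x"]) (auto simp: grid_def)
  qed (auto simp: grid_def PiE_def Pi_def)
  have "inj_on vec_lambda ((UNIV :: 'k set) \<rightarrow>\<^sub>E {1..int n})"
    by (intro inj_onI) (simp add: vec_lambda_inject)
  then show "card (grid n :: (int ^ 'k) set) = n ^ CARD('k)"
    unfolding eq by (simp add: card_image card_PiE)
  show "finite (grid n :: (int ^ 'k) set)"
    unfolding eq by (intro finite_imageI finite_PiE) simp_all
qed

text \<open>The shift \<open>m\<close> stays free here and is later taken near
  \<open>(1 - a) * n\<close>. The condition \<open>n \<le> 2 * m\<close> keeps the corner box of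
  side \<open>n - m\<close> disjoint from its translate by \<open>d\<close>.\<close>

lemma card_grid_sumfree:
  fixes S :: "(int ^ 'k::finite) set"
  assumes S: "S \<subseteq> grid n" "three_fold_sumfree S" and m: "m \<le> n" "n \<le> 2 * m"
  shows "(n - m) ^ CARD('k) \<le> n ^ CARD('k) - card S \<or>
    (m - 1) ^ CARD('k) \<le> 2 * (n ^ CARD('k) - card S)"
proof -
  define C where "C = grid n - S"
  define d :: "int ^ 'k" where "d = vec (int m)"
  have fin: "finite C" by (simp add: C_def card_grid)
  have C: "card C = n ^ CARD('k) - card S"
    unfolding C_def using S finite_subset[OF _ card_grid(1)]
    by (subst card_Diff_subset) (auto simp: card_grid)
  from S(2) show ?thesis
  proof (cases rule: three_fold_sumfree_cases[where d = d])
    case 1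
    define B :: "(int ^ 'k) set" where "B = grid (n - m)"
    \<comment> \<open>Splitting \<open>C\<close> along \<open>B\<close> ensures that no point of
      \<open>C\<close> is charged twice: \<open>x\<close> is charged inside \<open>B\<close>, and
      \<open>x + d\<close> outside it.\<close>
    have "B \<subseteq> (C \<inter> B) \<union> (\<lambda>x. x - d) ` (C - B)"
    proof
      fix x assume x: "x \<in> B"
      then have le: "1 \<le> x $ i" "x $ i \<le> int n - int m" for i
        using m by (auto simp: B_def grid_def of_nat_diff)
      have "x $ i \<le> int n" "1 \<le> x $ i + int m" "x $ i + int m \<le> int n" for i
        using le[of i] by linarith+
      then have "x \<in> grid n" "x + d \<in> grid n"
        using le by (simp_all add: grid_def d_def)
      moreover have "\<not> x $ i + int m \<le> int (n - m)" for i
        using le[of i] m by linarith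
      then have "x + d \<notin> B" by (simp add: B_def grid_def d_def)
      moreover have "x \<notin> S \<or> x + d \<notin> S" using 1 by blast
      ultimately have "x \<in> C \<inter> B \<or> x + d \<in> C - B"
        using x by (auto simp: C_def)
      then show "x \<in> (C \<inter> B) \<union> (\<lambda>x. x - d) ` (C - B)"
        by (metis UnI1 UnI2 add_diff_cancel_right' image_eqI)
    qed
    then have "card B \<le> card ((C \<inter> B) \<union> (\<lambda>x. x - d) ` (C - B))"
      by (intro card_mono) (auto simp: fin)
    also have "\<dots> \<le> card (C \<inter> B) + card (C - B)"
      by (meson card_Un_le card_image_le add_left_mono fin finite_Diff order_trans)
    also have "\<dots> = card C" using card_Int_Diff[OF fin] by simp
    finally show ?thesis by (simp add: B_def card_grid C)
  next
    case 2
    \<comment> \<open>The side is \<open>m - 1\<close> because both a coordinate and its reflection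
      \<open>m - x $ i\<close> must be at least 1.\<close>
    have "grid (m - 1) \<subseteq> C \<union> (\<lambda>x. d - x) ` C"
    proof
      fix x :: "int ^ 'k" assume x: "x \<in> grid (m - 1)"
      then have le: "1 \<le> x $ i" "x $ i \<le> int (m - 1)" for i
        by (auto simp: grid_def)
      have "x $ i \<le> int n" "1 \<le> int m - x $ i" "int m - x $ i \<le> int n" for i
        using le[of i] m by linarith+
      then have "x \<in> grid n" "d - x \<in> grid n"
        using le by (simp_all add: grid_def d_def)
      moreover have "x \<notin> S \<or> d - x \<notin> S" using 2 by blast
      ultimately have "x \<in> C \<or> d - x \<in> C"
        by (auto simp: C_def)
      moreover have "x = d - (d - x)" by simp
      ultimately show "x \<in> C \<union> (\<lambda>x. d - x) ` C" by blast
    qed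
    then have "card (grid (m - 1) :: (int ^ 'k) set) \<le> card (C \<union> (\<lambda>x. d - x) ` C)"
      by (intro card_mono) (auto simp: fin)
    also have "\<dots> \<le> card C + card C"
      by (meson card_Un_le card_image_le add_left_mono fin order_trans)
    finally show ?thesis by (simp add: card_grid C)
  qed
qed

lemma max_sumfree_card_attained:
  obtains S :: "(int ^ 'k::finite) set"
  where "S \<subseteq> grid n" "three_fold_sumfree S" "max_sumfree_card TYPE('k) n = card S"
  using Max_in[OF max_sumfree_card_wf[where 'k = 'k and n = n]]
  unfolding max_sumfree_card_def by blast

text \<open>The minimum covers both cases of the dichotomy; the terms \<open>1 / n\<close> absorb
  the rounding of \<open>(1 - a) * n\<close> to an integer.\<close>

lemma max_sumfree_card_bound:
  fixes a :: real
  assumes a: "0 < a" "a < 1 / 2" "(1 - a) ^ CARD('k::finite) = 2 * a ^ CARD('k)"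
    and n: "1 < a * real n"
  shows "real (max_sumfree_card TYPE('k) n) / real n ^ CARD('k) \<le>
    1 - min ((a - 1 / real n) ^ CARD('k)) ((1 - a - 1 / real n) ^ CARD('k) / 2)"
proof -
  let ?k = "CARD('k)"
  obtain S :: "(int ^ 'k) set"
    where S: "S \<subseteq> grid n" "three_fold_sumfree S" "max_sumfree_card TYPE('k) n = card S"
    by (rule max_sumfree_card_attained)
  \<comment> \<open>With the floor plus one, \<open>m > (1 - a) * n > n / 2\<close>, while
    \<open>n - m\<close> and \<open>m - 1\<close> fall short of \<open>a * n\<close> and
    \<open>(1 - a) * n\<close> by at most 1.\<close>
  define m where "m = nat \<lfloor>(1 - a) * real n\<rfloor> + 1"
  have n0: "real n > 0" using n a(1) by (cases "n = 0") auto
  have an: "a * real n < real n / 2" using a n0 by simp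
  have m: "real m \<le> (1 - a) * real n + 1" "(1 - a) * real n < real m"
    unfolding m_def using n an by (simp_all add: algebra_simps) linarith+
  have mn: "m \<le> n" "n \<le> 2 * m"
    using m[unfolded left_diff_distrib mult_1] an n by linarith+
  have card: "card S \<le> n ^ ?k"
    using card_mono[OF card_grid(1) S(1)] by (simp add: card_grid)
  \<comment> \<open>Passes from counts to densities for both cases at once, with
    \<open>c = 1\<close> for the translation and \<open>c = 2\<close> for the reflection.\<close>
  have scale: "q ^ ?k \<le> (1 - real (card S) / real n ^ ?k) * c"
    if "real j ^ ?k \<le> c * real (n ^ ?k - card S)" "0 \<le> q" "q * real n \<le> real j" for j q c
  proof -
    have "q ^ ?k * real n ^ ?k \<le> real j ^ ?k"
      using that n0 by (simp add: power_mult_distrib[symmetric] power_mono)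
    also have "\<dots> \<le> c * (real n ^ ?k - real (card S))"
      using that(1) card by (simp add: of_nat_diff)
    finally show ?thesis using n0 by (simp add: field_simps)
  qed
  have "0 \<le> a - 1 / real n" "0 \<le> 1 - a - 1 / real n"
    using n n0 an a by (simp_all add: field_simps)
  moreover have "(a - 1 / real n) * real n \<le> real (n - m)"
    "(1 - a - 1 / real n) * real n \<le> real (m - 1)"
    using n0 m mn by (simp_all add: algebra_simps of_nat_diff m_def)
  moreover have "real (n - m) ^ ?k \<le> 1 * real (n ^ ?k - card S) \<or>
      real (m - 1) ^ ?k \<le> 2 * real (n ^ ?k - card S)"
    using card_grid_sumfree[OF S(1,2) mn]
    by (metis mult_1 of_nat_le_iff of_nat_mult of_nat_numeral of_nat_power)
  ultimately have "(a - 1 / real n) ^ ?k \<le> (1 - real (card S) / real n ^ ?k) * 1 \<or>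
      (1 - a - 1 / real n) ^ ?k \<le> (1 - real (card S) / real n ^ ?k) * 2"
    using scale by blast
  then have "min ((a - 1 / real n) ^ ?k) ((1 - a - 1 / real n) ^ ?k / 2) \<le>
      1 - real (card S) / real n ^ ?k"
    unfolding min_le_iff_disj by (elim disj_forward) simp_all
  then show ?thesis unfolding S(3) by simp
qed

text \<open>As \<open>n\<close> grows, both arguments of the minimum tend to
  \<open>a ^ CARD('k)\<close>, by the balancing equation.\<close>

lemma c3_bound:
  fixes a :: real
  assumes a: "0 < a" "a < 1 / 2" "(1 - a) ^ CARD('k::finite) = 2 * a ^ CARD('k)"
  shows "c3 TYPE('k) \<le> ereal (1 - a ^ CARD('k))"
proof -
  let ?g = "\<lambda>n. 1 - min ((a - 1 / real n) ^ CARD('k)) ((1 - a - 1 / real n) ^ CARD('k) / 2)"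
  have "?g \<longlonglongrightarrow> 1 - min ((a - 0) ^ CARD('k)) ((1 - a - 0) ^ CARD('k) / 2)"
    by (intro tendsto_intros lim_1_over_n) auto
  then have "?g \<longlonglongrightarrow> 1 - a ^ CARD('k)" by (simp add: a(3))
  then have lim: "limsup (\<lambda>n. ereal (?g n)) = ereal (1 - a ^ CARD('k))"
    by (intro lim_imp_Limsup) auto
  have "eventually (\<lambda>n. 1 / a < real n) sequentially"
    using filterlim_real_sequentially by (simp add: filterlim_at_top_dense)
  then have "eventually (\<lambda>n. ereal (real (max_sumfree_card TYPE('k) n) / real n ^ CARD('k))
      \<le> ereal (?g n)) sequentially"
  proof eventually_elim
    case (elim n)
    then have "1 < a * real n" using a(1) by (simp add: field_simps)
    then show ?case using max_sumfree_card_bound[OF a] by simp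
  qed
  from Limsup_mono[OF this] show ?thesis unfolding c3_def lim .
qed

section \<open>Measurable sumfree subsets of the unit cube\<close>

text \<open>The reflection is scaling by -1 followed by a translation. The scaling is written as a
  preimage so that its measurability as a map applies.\<close>

lemma lmeasurable_reflection:
  fixes C :: "'a::euclidean_space set"
  assumes "C \<in> lmeasurable"
  shows "(\<lambda>x. d - x) ` C \<in> lmeasurable"
    and "measure lebesgue ((\<lambda>x. d - x) ` C) = measure lebesgue C"
proof -
  have eq: "(\<lambda>x. d - x) ` C = (+) d ` ((*\<^sub>R) (-1) -` C)"
  proof (intro set_eqI iffI)
    fix x assume "x \<in> (+) d ` ((*\<^sub>R) (-1) -` C)"
    then obtain y where "x = d - (- y)" "- y \<in> C" by auto
    then show "x \<in> (\<lambda>x. d - x) ` C" by (rule image_eqI)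
  next
    fix x assume "x \<in> (\<lambda>x. d - x) ` C"
    then obtain y where "x = d + - y" "y \<in> C" by auto
    then show "x \<in> (+) d ` ((*\<^sub>R) (-1) -` C)" by (intro image_eqI[where x = "- y"]) simp_all
  qed
  have "(*\<^sub>R) (-1) -` C \<in> sets lebesgue"
    using measurable_sets[OF lebesgue_measurable_scaling[of "-1"], of C] assms by auto
  then have "(\<lambda>x. d - x) ` C \<in> sets lebesgue"
    unfolding eq by (rule lebesgue_sets_translation)
  moreover have "emeasure lebesgue ((\<lambda>x. d - x) ` C) = emeasure lebesgue C"
    using emeasure_lebesgue_affine[of "-1" d C] by (simp add: image_image add.commute)
  ultimately show "(\<lambda>x. d - x) ` C \<in> lmeasurable"
    "measure lebesgue ((\<lambda>x. d - x) ` C) = measure lebesgue C"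
    using fmeasurableD2[OF assms]
    by (simp_all del: emeasure_completion add: fmeasurable_def measure_def less_top)
qed

lemma content_cube:
  fixes a :: real
  assumes "0 \<le> a"
  shows "measure lborel (cbox 0 (vec a :: real ^ 'k::finite)) = a ^ CARD('k)"
proof -
  have "cbox 0 (vec a :: real ^ 'k) \<noteq> {}" using assms by (simp add: interval_ne_empty_cart)
  then show ?thesis by (simp add: content_cbox_cart)
qed

text \<open>The same covering arguments as for the grid, now with the exact shift
  \<open>1 - a\<close> and hence without rounding loss.\<close>

lemma measure_sumfree_bound:
  fixes S :: "(real ^ 'k::finite) set"
  assumes a: "0 < a" "a < 1 / 2" "(1 - a) ^ CARD('k) = 2 * a ^ CARD('k)"
    and S: "S \<subseteq> unit_box" "S \<in> sets lebesgue" "three_fold_sumfree S"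
  shows "measure lebesgue S \<le> 1 - a ^ CARD('k)"
proof -
  have box: "(unit_box :: (real ^ 'k) set) = cbox 0 (vec 1)"
    by (auto simp: unit_box_def mem_box_cart)
  define C where "C = unit_box - S"
  define d :: "real ^ 'k" where "d = vec (1 - a)"
  have Sm: "S \<in> lmeasurable"
    by (rule fmeasurableI2[OF lmeasurable_cbox S(1)[unfolded box] S(2)])
  have Cm: "C \<in> lmeasurable" unfolding C_def box using Sm by (intro fmeasurable.Diff) auto
  have C: "measure lebesgue C = 1 - measure lebesgue S"
    unfolding C_def box using S(1) Sm content_cube[of 1, where 'k = 'k]
    by (subst measurable_measure_Diff) (auto simp: box)
  have "a ^ CARD('k) \<le> measure lebesgue C"
    using S(3)
  proof (cases rule: three_fold_sumfree_cases[where d = d])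
    case 1
    define B where "B = cbox 0 (vec a :: real ^ 'k)"
    have B: "B \<in> lmeasurable" by (simp add: B_def)
    have meas: "C \<inter> B \<in> lmeasurable" "C - B \<in> lmeasurable" "(\<lambda>x. x - d) ` (C - B) \<in> lmeasurable"
      using Cm B by (auto intro: fmeasurable.Int fmeasurable.Diff measurable_translation_subtract)
    have "B \<subseteq> (C \<inter> B) \<union> (\<lambda>x. x - d) ` (C - B)"
    proof
      fix x assume x: "x \<in> B"
      then have le: "0 \<le> x $ i" "x $ i \<le> a" for i
        by (auto simp: B_def mem_box_cart)
      have "x $ i \<le> 1" "0 \<le> x $ i + (1 - a)" "x $ i + (1 - a) \<le> 1" for i
        using le[of i] a(1,2) by linarith+
      then have "x \<in> unit_box" "x + d \<in> unit_box"
        using le by (simp_all add: unit_box_def d_def)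
      \<comment> \<open>Since \<open>a < 1 / 2\<close> is strict, the two closed corner cubes do not
        even touch.\<close>
      moreover have "\<not> x $ i + (1 - a) \<le> a" for i
        using le[of i] a(2) by linarith
      then have "x + d \<notin> B" by (simp add: B_def mem_box_cart d_def)
      moreover have "x \<notin> S \<or> x + d \<notin> S" using 1 by blast
      ultimately have "x \<in> C \<inter> B \<or> x + d \<in> C - B"
        using x by (auto simp: C_def)
      then show "x \<in> (C \<inter> B) \<union> (\<lambda>x. x - d) ` (C - B)"
        by (metis UnI1 UnI2 add_diff_cancel_right' image_eqI)
    qed
    then have "measure lebesgue B \<le> measure lebesgue ((C \<inter> B) \<union> (\<lambda>x. x - d) ` (C - B))"
      using B meas by (intro measure_mono_fmeasurable) (auto intro: fmeasurable.Un)
    also have "\<dots> \<le> measure lebesgue (C \<inter> B) + measure lebesgue ((\<lambda>x. x - d) ` (C - B))"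
      using meas by (intro measure_Un_le) auto
    also have "\<dots> = measure lebesgue (C \<inter> B) + measure lebesgue (C - B)"
      by (simp add: measure_translation_subtract)
    also have "\<dots> = measure lebesgue (C \<inter> B \<union> (C - B))"
    proof -
      have "C - B - C \<inter> B = C - B" by blast
      then show ?thesis using measure_Un2[OF meas(1,2)] by simp
    qed
    also have "C \<inter> B \<union> (C - B) = C" by blast
    finally show ?thesis using a by (simp add: B_def content_cube)
  next
    case 2
    \<comment> \<open>The reflection maps this cube of side \<open>1 - a\<close> onto itself, so
      each of its points or the mirror image lies in \<open>C\<close>.\<close>
    have "cbox 0 d \<subseteq> C \<union> (\<lambda>x. d - x) ` C"
    proof
      fix x assume x: "x \<in> cbox 0 d"
      then have le: "0 \<le> x $ i" "x $ i \<le> 1 - a" for i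
        by (auto simp: d_def mem_box_cart)
      have "x $ i \<le> 1" "0 \<le> 1 - a - x $ i" "1 - a - x $ i \<le> 1" for i
        using le[of i] a(1) by linarith+
      then have "x \<in> unit_box" "d - x \<in> unit_box"
        using le by (simp_all add: unit_box_def d_def)
      moreover have "x \<notin> S \<or> d - x \<notin> S" using 2 by blast
      ultimately have "x \<in> C \<or> d - x \<in> C"
        by (auto simp: C_def)
      moreover have "x = d - (d - x)" by simp
      ultimately show "x \<in> C \<union> (\<lambda>x. d - x) ` C" by blast
    qed
    then have "measure lebesgue (cbox 0 d) \<le> measure lebesgue (C \<union> (\<lambda>x. d - x) ` C)"
      using Cm lmeasurable_reflection(1)[OF Cm]
      by (intro measure_mono_fmeasurable) (auto intro: fmeasurable.Un)
    also have "\<dots> \<le> measure lebesgue C + measure lebesgue ((\<lambda>x. d - x) ` C)"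
      using Cm lmeasurable_reflection(1)[OF Cm] by (intro measure_Un_le) auto
    finally show ?thesis
      using a content_cube[of "1 - a", where 'k = 'k] lmeasurable_reflection(2)[OF Cm, of d]
      by (simp add: d_def)
  qed
  then show ?thesis using C by simp
qed

lemma c3_tilde_bound:
  fixes a :: real
  assumes "0 < a" "a < 1 / 2" "(1 - a) ^ CARD('k::finite) = 2 * a ^ CARD('k)"
  shows "c3_tilde TYPE('k) \<le> 1 - a ^ CARD('k)"
  unfolding c3_tilde_def
  by (rule cSup_least[OF c3_tilde_wf(2)]) (use measure_sumfree_bound[OF assms] in blast)

theorem theorem6p3:
  "c3 TYPE('k::finite) \<le> ereal (1 - 1 / (1 + 2 powr (1 / real CARD('k))) ^ CARD('k)) \<and>
   c3_tilde TYPE('k) \<le> 1 - 1 / (1 + 2 powr (1 / real CARD('k))) ^ CARD('k)"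
proof -
  note a = balanced_ratio[of "CARD('k)", OF zero_less_card_finite]
  show ?thesis
    using c3_bound[OF a] c3_tilde_bound[OF a] by (simp add: power_divide)
qed

end
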